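(* Let $n\ge 2$, let $f:\mathbb R^n\to[0,\infty)$ be an $L_p$-nested function, and consider the inverse polar-like coordinate transformation $(r,u_1,\dots,u_{n-1})\mapsto \boldsymbol x$ given by $x_i=ru_i$ for $i=1,\dots,n-1$ and $x_n=r\Delta_n u_n$, with $\Delta_n\in\{-1,1\}$ fixed and $u_n>0$ the function of $u_1,\dots,u_{n-1}$ determined by $f(u_1,\dots,u_{n-1},u_n)=1$. Let $\mathcal J$ be its Jacobian matrix (the matrix of partial derivatives of $x_1,\dots,x_n$ with respect to $r,u_1,\dots,u_{n-1}$). Let $\mathcal L$ be the set of multi-indices of the nodes on the path from the leaf corresponding to $u_n$ to the root node, including that leaf and excluding the root. Then, wherever these partial derivatives exist, $$|\det\mathcal J| = r^{n-1}\prod_{L\in\mathcal L}G_L(\boldsymbol u_{\widehat L}).$$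
   Context: **$L_p$-nested functions.** An $L_p$-nested function $f:\mathbb R^n\to[0,\infty)$ is given by a finite rooted ordered tree whose $n$ leaves, read from left to right, correspond to the coordinates $x_1,\dots,x_n$; every inner node $I$ has $\ell_I\ge 2$ children, denoted $(I,1),\dots,(I,\ell_I)$, and carries an exponent $p_I>0$. Nodes are denoted by multi-indices describing the path from the root; the root is $\emptyset$, and $(\emptyset,k)=k$. For a node $I$, $\boldsymbol x_I$ denotes the coordinates of $\boldsymbol x$ at leaves in the subtree under $I$, and $\boldsymbol x_{\widehat I}$ the remaining coordinates. Put $f_I(\boldsymbol x_I)=|x_i|$ if $I$ is the leaf of $x_i$, and $f_I(\boldsymbol x_I)=\left(\sum_{k=1}^{\ell_I} f_{I,k}(\boldsymbol x_{I,k})^{p_I}\right)^{1/p_I}$ if $I$ is an inner node; $f=f_\emptyset$. For leaves $I$ one uses the convention $p_I=1$. **Polar-like coordinates.** For $\boldsymbol x$ with $x_n\neq 0$: $r=f(\boldsymbol x)$, $u_i=x_i/f(\boldsymbol x)$ for $i\le n-1$, $\Delta_n=\operatorname{sgn}x_n$, $u_n=|x_n|/f(\boldsymbol x)$. The leaf of $u_n$ is the rightmost leaf of the tree, so every non-root node on the path from it to the root is the last child $(I,\ell_I)$ of its parent $I$. **The terms $G$.** Set $g_\emptyset=1$. Going down the path from the root to the leaf of $u_n$, for a node $(I,\ell_I)$ on this path define recursively $$g_{I,\ell_I}(\boldsymbol u_{\widehat{I,\ell_I}})=\Big(g_I(\boldsymbol u_{\widehat I})^{p_I}-\sum_{j=1}^{\ell_I-1}f_{I,j}(\boldsymbol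 u_{I,j})^{p_I}\Big)^{1/p_I},\qquad G_{I,\ell_I}(\boldsymbol u_{\widehat{I,\ell_I}})=g_{I,\ell_I}(\boldsymbol u_{\widehat{I,\ell_I}})^{\,p_{I,\ell_I}-p_I}.$$ Thus $g_{I,\ell_I}$ is the value at node $(I,\ell_I)$ expressed through the leaves outside its subtree when the root value is fixed to one; in particular $u_n$ equals $g$ at its leaf. *)

theory Defs
  imports "HOL-Analysis.Derivative" "HOL-Library.Sublist" "Jordan_Normal_Form.Determinant"
begin

text \<open>
  Points of $n$-dimensional space are functions \<open>x :: nat \<Rightarrow> real\<close> of which only the
  coordinates \<open>x 1, \<dots>, x n\<close> matter. A leaf carries the number of its coordinate, an inner
  node its exponent and the ordered list of its children.
\<close>

datatype lp_tree = Leaf nat | Node real "lp_tree list"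

fun leaves :: "lp_tree \<Rightarrow> nat list" where
  "leaves (Leaf i) = [i]"
| "leaves (Node p ts) = concat (map leaves ts)"

fun wf_lp_tree :: "lp_tree \<Rightarrow> bool" where
  "wf_lp_tree (Leaf i) = True"
| "wf_lp_tree (Node p ts) = (p > 0 \<and> length ts \<ge> 2 \<and> (\<forall>t\<in>set ts. wf_lp_tree t))"

definition lp_nested_tree :: "nat \<Rightarrow> lp_tree \<Rightarrow> bool" where
  "lp_nested_tree n T \<longleftrightarrow> wf_lp_tree T \<and> leaves T = [1..<Suc n]"

fun lp_nested :: "lp_tree \<Rightarrow> (nat \<Rightarrow> real) \<Rightarrow> real" where
  "lp_nested (Leaf i) x = \<bar>x i\<bar>"
| "lp_nested (Node p ts) x = (\<Sum>t\<leftarrow>ts. lp_nested t x powr p) powr (1 / p)"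

text \<open>
  Nodes are addressed by multi-indices: \<open>[]\<close> is the root and \<open>I @ [k]\<close>, with \<open>k \<ge> 1\<close>, is
  the \<open>k\<close>-th child of \<open>I\<close>. The values of \<^term>\<open>subtree_at\<close> off the tree are irrelevant.
\<close>

fun is_node :: "lp_tree \<Rightarrow> nat list \<Rightarrow> bool" where
  "is_node T [] = True"
| "is_node (Leaf i) (k # I) = False"
| "is_node (Node p ts) (k # I) = (1 \<le> k \<and> k \<le> length ts \<and> is_node (ts ! (k - 1)) I)"

fun subtree_at :: "lp_tree \<Rightarrow> nat list \<Rightarrow> lp_tree" where
  "subtree_at T [] = T"
| "subtree_at (Leaf i) (k # I) = Leaf i"
| "subtree_at (Node p ts) (k # I) = subtree_at (ts ! (k - 1)) I"

fun root_exponent :: "lp_tree \<Rightarrow> real" where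
  "root_exponent (Leaf i) = 1"
| "root_exponent (Node p ts) = p"

fun root_arity :: "lp_tree \<Rightarrow> nat" where
  "root_arity (Leaf i) = 0"
| "root_arity (Node p ts) = length ts"

definition node_exponent :: "lp_tree \<Rightarrow> nat list \<Rightarrow> real" where
  "node_exponent T I = root_exponent (subtree_at T I)"

definition node_arity :: "lp_tree \<Rightarrow> nat list \<Rightarrow> nat" where
  "node_arity T I = root_arity (subtree_at T I)"

definition node_value :: "lp_tree \<Rightarrow> nat list \<Rightarrow> (nat \<Rightarrow> real) \<Rightarrow> real" where
  "node_value T I x = lp_nested (subtree_at T I) x"

text \<open>The nodes between the leaf of coordinate \<open>i\<close> (included) and the root (excluded).\<close>

definition leaf_path :: "lp_tree \<Rightarrow> nat \<Rightarrow> nat list set" where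
  "leaf_path T i =
     {L. L \<noteq> [] \<and> (\<exists>K. is_node T K \<and> subtree_at T K = Leaf i \<and> prefix L K)}"

text \<open>
  In the next two definitions, \<open>L\<close> is the last child of its parent \<open>butlast L\<close>, and so are all
  its non-root ancestors; the values for other \<open>L\<close> are irrelevant. Only coordinates of \<open>u\<close>
  outside the subtree under \<open>L\<close> are used.
\<close>

function g_term :: "lp_tree \<Rightarrow> (nat \<Rightarrow> real) \<Rightarrow> nat list \<Rightarrow> real" where
  "g_term T u L =
     (if L = [] then 1
      else (let I = butlast L; p = node_exponent T I in
        (g_term T u I powr p - (\<Sum>j = 1..<node_arity T I. node_value T (I @ [j]) u powr p))
          powr (1 / p)))"
  by pat_completeness auto
termination
  by (relation "measure (\<lambda>(T, u, L). length L)") auto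

declare g_term.simps [simp del]

definition G_term :: "lp_tree \<Rightarrow> (nat \<Rightarrow> real) \<Rightarrow> nat list \<Rightarrow> real" where
  "G_term T u L = g_term T u L powr (node_exponent T L - node_exponent T (butlast L))"

text \<open>
  The function \<open>u\<^sub>n\<close> of \<open>u 1, \<dots>, u (n - 1)\<close>. It is meaningful exactly on
  \<open>polar_domain\<close>; the value \<open>u n\<close> is not used.
\<close>

definition polar_domain :: "lp_tree \<Rightarrow> nat \<Rightarrow> (nat \<Rightarrow> real) set" where
  "polar_domain T n = {u. \<exists>s>0. lp_nested T (u(n := s)) = 1}"

definition last_polar :: "lp_tree \<Rightarrow> nat \<Rightarrow> (nat \<Rightarrow> real) \<Rightarrow> real" where
  "last_polar T n u = (THE s. s > 0 \<and> lp_nested T (u(n := s)) = 1)"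

text \<open>
  The parameters \<open>(r, u\<^sub>1, \<dots>, u\<^bsub>n-1\<^esub>)\<close> form one vector \<open>q\<close> with
  \<open>q 0 = r\<close> and \<open>q i = u\<^sub>i\<close> for \<open>1 \<le> i < n\<close>. As no leaf is numbered \<open>0\<close>, the entry \<open>q 0\<close>
  has no influence on \<open>last_polar T n q\<close>.
\<close>

definition polar_inverse :: "lp_tree \<Rightarrow> nat \<Rightarrow> real \<Rightarrow> (nat \<Rightarrow> real) \<Rightarrow> nat \<Rightarrow> real" where
  "polar_inverse T n \<Delta> q i =
     (if i = n then q 0 * \<Delta> * last_polar T n q else q 0 * q i)"

definition has_partial_deriv :: "((nat \<Rightarrow> real) \<Rightarrow> real) \<Rightarrow> nat \<Rightarrow> (nat \<Rightarrow> real) \<Rightarrow> bool" where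
  "has_partial_deriv F j q \<longleftrightarrow> (\<lambda>t. F (q(j := t))) field_differentiable at (q j)"

definition partial_deriv :: "((nat \<Rightarrow> real) \<Rightarrow> real) \<Rightarrow> nat \<Rightarrow> (nat \<Rightarrow> real) \<Rightarrow> real" where
  "partial_deriv F j q = deriv (\<lambda>t. F (q(j := t))) (q j)"

text \<open>
  Matrix indices start at \<open>0\<close>: row \<open>i\<close> belongs to coordinate \<open>Suc i\<close> of the image, column \<open>0\<close>
  to \<open>r\<close>, and column \<open>j \<ge> 1\<close> to \<open>u\<^sub>j\<close>.
\<close>

definition polar_jacobian :: "lp_tree \<Rightarrow> nat \<Rightarrow> real \<Rightarrow> (nat \<Rightarrow> real) \<Rightarrow> real mat" where
  "polar_jacobian T n \<Delta> q =
     Matrix.mat n n (\<lambda>(i, j). partial_deriv (\<lambda>q. polar_inverse T n \<Delta> q (Suc i)) j q)"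

end

theory Submission imports Defs begin

text \<open>
  Column operations reduce the determinant to \<open>\<plusminus> r ^ (n - 1) * (u\<^sub>n - (\<Sum>j. u\<^sub>j * \<partial>\<^sub>j u\<^sub>n))\<close>.
  Near a point of the domain, \<open>u\<^sub>n\<close> is the explicit term \<open>g\<close> at the rightmost leaf. Write
  \<open>E F = (\<Sum>j. u\<^sub>j * \<partial>\<^sub>j F)\<close>. Euler's identity gives \<open>E f\<^sub>I = f\<^sub>I\<close> for the subtrees off the
  rightmost path, so if \<open>L\<close> is the last child of \<open>I\<close>, then
  \<open>g\<^sub>L - E g\<^sub>L = (g\<^sub>I / g\<^sub>L) powr (p\<^sub>I - 1) * (g\<^sub>I - E g\<^sub>I)\<close>. By induction along the path,
  \<open>g\<^sub>L - E g\<^sub>L = g\<^sub>L powr (1 - p\<^sub>L)\<close> times the product of the \<open>G\<close> terms down to \<open>L\<close>, and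
  \<open>p\<^sub>L = 1\<close> at the leaf.
\<close>

section \<open>The path to the rightmost leaf\<close>

lemma size_last_le [termination_simp]: "ts \<noteq> [] \<Longrightarrow> size (last ts) \<le> size_list size ts"
  by (intro size_list_estimation'[of "last ts"]) auto

text \<open>Children are numbered from 1, so the entry for the last child is the number of children.
  The empty child list is a dummy case, excluded by well-formedness.\<close>

fun last_path :: "lp_tree \<Rightarrow> nat list" where
  "last_path (Leaf i) = []"
| "last_path (Node p []) = []"
| "last_path (Node p (t # ts)) = Suc (length ts) # last_path (last (t # ts))"

lemma leaves_nonempty: "wf_lp_tree T \<Longrightarrow> leaves T \<noteq> []"
proof (induction T)
  case (Node p ts)
  then have "ts \<noteq> []" by auto
  with Node show ?case by (cases ts) auto
qed simp

lemma leaves_Node_snoc: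
  "ts \<noteq> [] \<Longrightarrow> leaves (Node p ts) = concat (map leaves (butlast ts)) @ leaves (last ts)"
  by (cases ts rule: rev_cases) auto

lemma last_path_Node: "ts \<noteq> [] \<Longrightarrow> last_path (Node p ts) = length ts # last_path (last ts)"
  by (cases ts) auto

lemma subtree_at_append: "subtree_at T (I @ J) = subtree_at (subtree_at T I) J"
proof (induction T I rule: subtree_at.induct)
  case (2 i k I)
  then show ?case by (cases J) auto
qed auto

text \<open>The prefixes \<open>take k\<close> are the nodes on this path, and one induction on the
  tree serves all four facts. The suffix property later shows that the leaves below such a node form
  a final segment of the coordinates.\<close>

lemma subtree_at_last_path:
  assumes "wf_lp_tree T" "k \<le> length (last_path T)"
  shows "last_path (subtree_at T (take k (last_path T))) = drop k (last_path T)"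
    and "wf_lp_tree (subtree_at T (take k (last_path T)))"
    and "suffix (leaves (subtree_at T (take k (last_path T)))) (leaves T)"
    and "is_node T (take k (last_path T))"
proof -
  have "last_path (subtree_at T (take k (last_path T))) = drop k (last_path T)
    \<and> wf_lp_tree (subtree_at T (take k (last_path T)))
    \<and> suffix (leaves (subtree_at T (take k (last_path T)))) (leaves T)
    \<and> is_node T (take k (last_path T))"
    using assms
  proof (induction T arbitrary: k)
    case (Node p ts)
    from Node.prems have ts: "ts \<noteq> []" by auto
    show ?case
    proof (cases k)
      case (Suc k')
      have "suffix (leaves (last ts)) (leaves (Node p ts))"
        using leaves_Node_snoc[OF ts] by (simp add: suffix_def)
      with Node.IH[of "last ts" k'] Node.prems ts Suc show ?thesis
        by (auto simp: last_path_Node last_conv_nth Suc_le_eq simp del: leaves.simps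
            intro: suffix_order.trans)
    qed (use Node.prems in auto)
  qed auto
  then show "last_path (subtree_at T (take k (last_path T))) = drop k (last_path T)"
    and "wf_lp_tree (subtree_at T (take k (last_path T)))"
    and "suffix (leaves (subtree_at T (take k (last_path T)))) (leaves T)"
    and "is_node T (take k (last_path T))" by blast+
qed

lemma subtree_at_last_path_Leaf:
  assumes "wf_lp_tree T"
  shows "subtree_at T (last_path T) = Leaf (last (leaves T))"
  using assms
proof (induction T)
  case (Node p ts)
  then have ts: "ts \<noteq> []" by auto
  with Node have "leaves (last ts) \<noteq> []" by (auto intro!: leaves_nonempty)
  then have "last (leaves (Node p ts)) = last (leaves (last ts))"
    using leaves_Node_snoc[OF ts, of p] by simp
  with Node ts show ?case
    by (simp add: last_path_Node last_conv_nth flip: One_nat_def)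
qed auto

lemma leaf_in_leaves: "is_node T K \<Longrightarrow> subtree_at T K = Leaf i \<Longrightarrow> i \<in> set (leaves T)"
proof (induction T K rule: is_node.induct)
  case (3 p ts k I)
  then have "ts ! (k - 1) \<in> set ts" by auto
  with 3 show ?case by auto
qed auto

text \<open>A path through another child would place the last leaf both under that child and under
  the last one, against distinctness of the leaves.\<close>

lemma last_path_unique:
  assumes "wf_lp_tree T" "distinct (leaves T)" "is_node T K"
    "subtree_at T K = Leaf (last (leaves T))"
  shows "K = last_path T"
  using assms
proof (induction T arbitrary: K)
  case (Leaf i)
  then show ?case by (cases K) auto
next
  case (Node p ts)
  from Node.prems have ts: "ts \<noteq> []" by auto
  have ne: "leaves (last ts) \<noteq> []" using Node.prems ts by (auto intro!: leaves_nonempty)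
  have last: "last (leaves (Node p ts)) = last (leaves (last ts))"
    using leaves_Node_snoc[OF ts, of p] ne by simp
  obtain k I where K: "K = k # I" using Node.prems by (cases K) auto
  have k: "1 \<le> k" "k \<le> length ts" "is_node (ts ! (k - 1)) I"
    "subtree_at (ts ! (k - 1)) I = Leaf (last (leaves (last ts)))"
    using Node.prems K last by auto
  have disj: "set (concat (map leaves (butlast ts))) \<inter> set (leaves (last ts)) = {}"
    and dist: "distinct (leaves (last ts))"
    using Node.prems(2) unfolding leaves_Node_snoc[OF ts] distinct_append by auto
  have "k = length ts"
  proof (rule ccontr)
    assume "k \<noteq> length ts"
    with k have "ts ! (k - 1) \<in> set (butlast ts)"
      by (auto simp: in_set_conv_nth nth_butlast intro!: exI[of _ "k - 1"])
    moreover have "last (leaves (last ts)) \<in> set (leaves (ts ! (k - 1)))"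
      using leaf_in_leaves k(3,4) by blast
    ultimately show False using disj ne last_in_set[OF ne] by auto
  qed
  with k have "is_node (last ts) I" "subtree_at (last ts) I = Leaf (last (leaves (last ts)))"
    using ts by (auto simp: last_conv_nth)
  from Node.IH[OF _ _ dist this] Node.prems ts have "I = last_path (last ts)" by auto
  then show ?case using K \<open>k = length ts\<close> ts by (simp add: last_path_Node)
qed

section \<open>Elementary properties of nested functions\<close>

lemma lp_nested_nonneg: "lp_nested T x \<ge> 0"
  by (cases T) auto

lemma lp_nested_cong: "(\<And>i. i \<in> set (leaves T) \<Longrightarrow> x i = y i) \<Longrightarrow> lp_nested T x = lp_nested T y"
proof (induction T)
  case (Node p ts)
  then have "map (\<lambda>t. lp_nested t x powr p) ts = map (\<lambda>t. lp_nested t y powr p) ts"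
    by (intro map_cong) (auto intro!: arg_cong[where f = "\<lambda>a. a powr p"])
  then show ?case by (simp only: lp_nested.simps)
qed auto

text \<open>A vanishing sum of nonnegative powers has only vanishing terms. This serves the zero
  case of Euler's identity and the positivity of node values.\<close>

lemma lp_nested_eq_0D:
  "wf_lp_tree T \<Longrightarrow> lp_nested T x = 0 \<Longrightarrow> i \<in> set (leaves T) \<Longrightarrow> x i = 0"
proof (induction T)
  case (Node p ts)
  then have "(\<Sum>t\<leftarrow>ts. lp_nested t x powr p) = 0" by simp
  then have "\<forall>t\<in>set ts. lp_nested t x powr p = 0"
    by (subst (asm) sum_list_nonneg_eq_0_iff) auto
  with Node show ?case by auto
qed auto

section \<open>Radial derivatives and Euler's identity\<close>

text \<open>
  The derivative \<open>c = (\<Sum>j\<in>A. u j * \<partial>\<^sub>j F)\<close> is taken coordinatewise and ignores coordinates with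
  \<open>u j = 0\<close>, where partial derivatives of \<^term>\<open>lp_nested T\<close> need not exist.
\<close>

definition has_radial_deriv ::
  "((nat \<Rightarrow> real) \<Rightarrow> real) \<Rightarrow> real \<Rightarrow> nat set \<Rightarrow> (nat \<Rightarrow> real) \<Rightarrow> bool" where
  "has_radial_deriv F c A u \<longleftrightarrow>
     (\<exists>d. (\<forall>j\<in>A. u j \<noteq> 0 \<longrightarrow> ((\<lambda>t. F (u(j := t))) has_real_derivative d j) (at (u j))) \<and>
       c = (\<Sum>j\<in>A. u j * d j))"

lemma has_radial_deriv_const: "has_radial_deriv (\<lambda>_. a) 0 A u"
  unfolding has_radial_deriv_def by (intro exI[of _ "\<lambda>_. 0"]) auto

lemma has_radial_deriv_add:
  assumes "has_radial_deriv F a A u" "has_radial_deriv G b A u"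
  shows "has_radial_deriv (\<lambda>x. F x + G x) (a + b) A u"
proof -
  from assms obtain d e where
    "\<forall>j\<in>A. u j \<noteq> 0 \<longrightarrow> ((\<lambda>t. F (u(j := t))) has_real_derivative d j) (at (u j))"
    "a = (\<Sum>j\<in>A. u j * d j)"
    "\<forall>j\<in>A. u j \<noteq> 0 \<longrightarrow> ((\<lambda>t. G (u(j := t))) has_real_derivative e j) (at (u j))"
    "b = (\<Sum>j\<in>A. u j * e j)"
    unfolding has_radial_deriv_def by blast
  then show ?thesis unfolding has_radial_deriv_def
    by (intro exI[of _ "\<lambda>j. d j + e j"])
      (auto intro!: derivative_intros simp: sum.distrib algebra_simps)
qed

lemma has_radial_deriv_chain:
  assumes "has_radial_deriv F a A u" "(h has_real_derivative b) (at (F u))"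
  shows "has_radial_deriv (\<lambda>x. h (F x)) (b * a) A u"
proof -
  from assms obtain d where d:
    "\<forall>j\<in>A. u j \<noteq> 0 \<longrightarrow> ((\<lambda>t. F (u(j := t))) has_real_derivative d j) (at (u j))"
    "a = (\<Sum>j\<in>A. u j * d j)"
    unfolding has_radial_deriv_def by blast
  have "((\<lambda>t. h (F (u(j := t)))) has_real_derivative b * d j) (at (u j))"
    if "j \<in> A" "u j \<noteq> 0" for j
    using DERIV_chain2[of h b "\<lambda>t. F (u(j := t))" "u j"] assms(2) d that by simp
  with d show ?thesis unfolding has_radial_deriv_def
    by (intro exI[of _ "\<lambda>j. b * d j"]) (auto simp: sum_distrib_left algebra_simps)
qed

lemma has_radial_deriv_powr:
  assumes "has_radial_deriv F a A u" "F u > 0"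
  shows "has_radial_deriv (\<lambda>x. F x powr e) (e * F u powr (e - 1) * a) A u"
  using has_radial_deriv_chain[OF assms(1) has_real_derivative_powr[OF assms(2)]] .

lemma has_radial_deriv_diff:
  assumes "has_radial_deriv F a A u" "has_radial_deriv G b A u"
  shows "has_radial_deriv (\<lambda>x. F x - G x) (a - b) A u"
proof -
  have "((\<lambda>t. - t) has_real_derivative - 1) (at (G u))"
    by (auto intro!: derivative_eq_intros)
  from has_radial_deriv_add[OF assms(1) has_radial_deriv_chain[OF assms(2) this]]
  show ?thesis by simp
qed

lemma has_radial_deriv_sum_list:
  assumes "\<And>t. t \<in> set ts \<Longrightarrow> has_radial_deriv (F t) (a t) A u"
  shows "has_radial_deriv (\<lambda>x. \<Sum>t\<leftarrow>ts. F t x) (\<Sum>t\<leftarrow>ts. a t) A u"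
  using assms by (induction ts) (auto intro: has_radial_deriv_const has_radial_deriv_add)

text \<open>All coordinates under the tree vanish, so the radial derivative ignores them; the others
  do not influence \<open>lp_nested T\<close>. Hence \<open>h\<close> needs no differentiability,
  which matters for powers at 0.\<close>

lemma has_radial_deriv_lp_nested_0:
  assumes "wf_lp_tree T" "lp_nested T u = 0"
  shows "has_radial_deriv (\<lambda>x. h (lp_nested T x)) 0 A u"
proof -
  have "((\<lambda>t. h (lp_nested T (u(j := t)))) has_real_derivative 0) (at (u j))" if "u j \<noteq> 0" for j
  proof -
    have "j \<notin> set (leaves T)" using lp_nested_eq_0D[OF assms] that by blast
    then have "lp_nested T (u(j := t)) = lp_nested T u" for t
      by (intro lp_nested_cong) auto
    then show ?thesis by simp
  qed
  then show ?thesis unfolding has_radial_deriv_def by (intro exI[of _ "\<lambda>_. 0"]) auto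
qed

text \<open>The chain rule for \<open>powr\<close> needs a positive base. At value 0 the preceding
  lemma takes over, and \<open>0 powr e = 0\<close> makes the formula agree.\<close>

lemma has_radial_deriv_lp_nested_powr:
  assumes "wf_lp_tree T" "has_radial_deriv (lp_nested T) (lp_nested T u) A u"
  shows "has_radial_deriv (\<lambda>x. lp_nested T x powr e) (e * lp_nested T u powr e) A u"
proof (cases "lp_nested T u = 0")
  case True
  then show ?thesis using has_radial_deriv_lp_nested_0[OF assms(1) True] by simp
next
  case False
  then have pos: "lp_nested T u > 0" using lp_nested_nonneg[of T u] by simp
  have "lp_nested T u powr (e - 1) * lp_nested T u = lp_nested T u powr e"
    using pos by (simp add: powr_diff)
  with has_radial_deriv_powr[OF assms(2) pos, of e] show ?thesis by (simp add: mult.assoc)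
qed

text \<open>Euler's identity for degree one, by induction: the sum of \<open>p\<close>-th powers has
  radial derivative \<open>p\<close> times itself, and taking the root cancels that factor.\<close>

lemma has_radial_deriv_lp_nested:
  assumes "wf_lp_tree T" "set (leaves T) \<subseteq> A" "finite A"
  shows "has_radial_deriv (lp_nested T) (lp_nested T u) A u"
  using assms
proof (induction T)
  case (Leaf i)
  \<comment> \<open>Away from 0, the gradient of the norm on the reals is the derivative of the
    absolute value.\<close>
  have "((\<lambda>t. \<bar>(u(j := t)) i\<bar>) has_real_derivative (if j = i then sgn (u i) else 0)) (at (u j))"
    if "u j \<noteq> 0" for j
    using that GDERIV_norm[of "u i"] by (cases "j = i") (auto simp: gderiv_deriv)
  moreover have "\<bar>u i\<bar> = (\<Sum>j\<in>A. u j * (if j = i then sgn (u i) else 0))"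
    using Leaf by (simp add: if_distrib[of "\<lambda>a. _ * a"] abs_sgn cong: if_cong)
  ultimately show ?case unfolding has_radial_deriv_def lp_nested.simps
    by (intro exI[of _ "\<lambda>j. if j = i then sgn (u i) else 0"]) auto
next
  case (Node p ts)
  define S where "S x = (\<Sum>t\<leftarrow>ts. lp_nested t x powr p)" for x
  have p: "p > 0" using Node by simp
  show ?case
  proof (cases "lp_nested (Node p ts) u = 0")
    case True
    then show ?thesis using has_radial_deriv_lp_nested_0[OF Node.prems(1) True, of id] by simp
  next
    case False
    have "S u \<ge> 0" unfolding S_def by (intro sum_list_nonneg) auto
    with False have pos: "S u > 0" by (cases "S u = 0") (auto simp: S_def)
    have "has_radial_deriv S (\<Sum>t\<leftarrow>ts. p * lp_nested t u powr p) A u"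
      unfolding S_def using Node
      by (intro has_radial_deriv_sum_list has_radial_deriv_lp_nested_powr) auto
    then have "has_radial_deriv S (p * S u) A u" by (simp add: S_def sum_list_const_mult)
    from has_radial_deriv_powr[OF this pos, of "1 / p"]
    have "has_radial_deriv (\<lambda>x. S x powr (1 / p)) (S u powr (1 / p)) A u"
      using p pos by (simp add: powr_diff)
    then show ?thesis by (simp add: S_def)
  qed
qed

text \<open>Where \<open>u j = 0\<close>, \<open>partial_deriv\<close> may be a meaningless value of
  \<open>deriv\<close>, but it is weighted by 0.\<close>

lemma has_radial_deriv_imp_partial_deriv:
  assumes "has_radial_deriv F c A u"
  shows "c = (\<Sum>j\<in>A. u j * partial_deriv F j u)"
proof -
  from assms obtain d where d:
    "\<forall>j\<in>A. u j \<noteq> 0 \<longrightarrow> ((\<lambda>t. F (u(j := t))) has_real_derivative d j) (at (u j))"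
    "c = (\<Sum>j\<in>A. u j * d j)"
    unfolding has_radial_deriv_def by blast
  have "u j * d j = u j * partial_deriv F j u" if "j \<in> A" for j
    using d(1) that by (cases "u j = 0") (auto simp: partial_deriv_def DERIV_imp_deriv)
  with d(2) show ?thesis by (simp cong: sum.cong)
qed

lemma has_radial_deriv_imp_isCont:
  assumes "has_radial_deriv F c A u" "j \<in> A" "u j \<noteq> 0"
  shows "isCont (\<lambda>t. F (u(j := t))) (u j)"
  using assms unfolding has_radial_deriv_def by (blast intro: DERIV_isCont)

section \<open>The g terms on the rightmost path and the function u_n\<close>

locale nested_tree =
  fixes n :: nat and T :: lp_tree
  assumes tree: "lp_nested_tree n T"
begin

text \<open>Nodes on the path are numbered by their distance from the root: \<open>node 0\<close> is
  the root, \<open>node depth\<close> the leaf of coordinate \<open>n\<close>.\<close>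

definition node :: "nat \<Rightarrow> nat list" where "node k = take k (last_path T)"
definition depth :: nat where "depth = length (last_path T)"
definition expo :: "nat \<Rightarrow> real" where "expo k = node_exponent T (node k)"
definition side_sum :: "nat \<Rightarrow> (nat \<Rightarrow> real) \<Rightarrow> real" where
  "side_sum k x = (\<Sum>j = 1..<node_arity T (node k). node_value T (node k @ [j]) x powr expo k)"
text \<open>The base of the power that defines \<open>g_term\<close> at \<open>node (Suc k)\<close>.
  Its positivity for all \<open>k < depth\<close> is the explicit form of membership in the domain
  with which the proofs work.\<close>

definition remainder :: "nat \<Rightarrow> (nat \<Rightarrow> real) \<Rightarrow> real" where
  "remainder k x = g_term T x (node k) powr expo k - side_sum k x"

lemma wf: "wf_lp_tree T" and leaves: "leaves T = [1..<Suc n]"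
  using tree unfolding lp_nested_tree_def by auto

lemma n_pos: "n \<ge> 1"
  using leaves leaves_nonempty[OF wf] by (cases n) auto

lemma last_leaves: "last (leaves T) = n"
  unfolding leaves using n_pos by simp

lemma g_term_node_0: "g_term T x (node 0) = 1"
  by (simp add: node_def g_term.simps)

lemma g_term_node_Suc:
  assumes "k < depth"
  shows "g_term T x (node (Suc k)) = remainder k x powr (1 / expo k)"
proof -
  have "node (Suc k) \<noteq> []" "butlast (node (Suc k)) = node k"
    using assms by (auto simp: node_def depth_def butlast_take)
  then show ?thesis
    by (subst g_term.simps) (simp add: Let_def remainder_def side_sum_def expo_def)
qed

lemma node_depth: "subtree_at T (node depth) = Leaf n"
  using subtree_at_last_path_Leaf[OF wf] last_leaves by (simp add: node_def depth_def)

lemma expo_depth: "expo depth = 1"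
  by (simp add: expo_def node_exponent_def node_depth)

lemma suffix_leaves:
  assumes "k \<le> depth"
  shows "suffix (leaves (subtree_at T (node k))) (leaves T)"
  using subtree_at_last_path[OF wf] assms by (simp add: node_def depth_def)

lemma n_in_leaves:
  assumes "k \<le> depth"
  shows "n \<in> set (leaves (subtree_at T (node k)))"
proof -
  have "leaves (subtree_at T (node k)) \<noteq> []"
    using subtree_at_last_path[OF wf] assms by (intro leaves_nonempty) (auto simp: node_def depth_def)
  with suffix_leaves[OF assms] last_leaves show ?thesis
    by (metis last_appendR last_in_set suffix_def)
qed

text \<open>Coordinate \<open>n\<close> lies under the last child and the leaves are distinct, so
  the other children carry only coordinates below \<open>n\<close>.\<close>

lemma inner_node:
  assumes "k < depth"
  obtains ts where "subtree_at T (node k) = Node (expo k) ts" "expo k > 0" "ts \<noteq> []"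
    "node (Suc k) = node k @ [length ts]"
    "\<And>t. t \<in> set (butlast ts) \<Longrightarrow> wf_lp_tree t \<and> set (leaves t) \<subseteq> {1..<n}"
proof -
  define S where "S = subtree_at T (node k)"
  have drop: "last_path S = drop k (last_path T)" and wfS: "wf_lp_tree S"
    using subtree_at_last_path[OF wf] assms by (auto simp: node_def depth_def S_def)
  have "last_path S \<noteq> []" using drop assms by (simp add: depth_def)
  then obtain p ts where S: "S = Node p ts" by (cases S) auto
  have ts: "ts \<noteq> []" using wfS S by auto
  have p: "expo k = p" using S by (simp add: S_def expo_def node_exponent_def)
  have "last_path T ! k = length ts"
    using drop S ts assms by (metis depth_def last_path_Node nth_via_drop)
  then have Suc: "node (Suc k) = node k @ [length ts]"
    using assms by (simp add: node_def depth_def take_Suc_conv_app_nth)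
  have sub: "subtree_at T (node (Suc k)) = last ts"
    using S ts unfolding Suc subtree_at_append S_def[symmetric] by (simp add: last_conv_nth)
  have n: "n \<in> set (leaves (last ts))" using n_in_leaves[of "Suc k"] assms sub by simp
  have "suffix (leaves S) (leaves T)" unfolding S_def using suffix_leaves assms by simp
  then have "distinct (leaves S)" "set (leaves S) \<subseteq> {1..n}"
    using arg_cong[OF leaves, of distinct] arg_cong[OF leaves, of set]
    by (auto simp: suffix_def simp del: upt_Suc dest!: equalityD1)
  then have "set (leaves t) \<subseteq> {1..<n}" if "t \<in> set (butlast ts)" for t
  proof -
    have "set (leaves t) \<subseteq> set (concat (map leaves (butlast ts)))" using that by auto
    moreover have "n \<notin> set (concat (map leaves (butlast ts)))"
      "set (concat (map leaves (butlast ts))) \<subseteq> {1..n}"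
      using \<open>distinct (leaves S)\<close> \<open>set (leaves S) \<subseteq> {1..n}\<close> n
      unfolding S leaves_Node_snoc[OF ts] distinct_append set_append by blast+
    ultimately show ?thesis
      by (metis atLeastLessThan_iff atLeastAtMost_iff le_neq_implies_less subset_iff)
  qed
  moreover have "wf_lp_tree t" if "t \<in> set (butlast ts)" for t
    using wfS S in_set_butlastD[OF that] by auto
  ultimately show ?thesis using that S S_def p ts Suc wfS by auto
qed

lemma side_sum_conv:
  assumes "subtree_at T (node k) = Node (expo k) ts"
  shows "side_sum k x = (\<Sum>t\<leftarrow>butlast ts. lp_nested t x powr expo k)"
proof -
  have "side_sum k x = (\<Sum>j = 1..<length ts. lp_nested (ts ! (j - 1)) x powr expo k)"
    by (simp add: side_sum_def node_arity_def node_value_def subtree_at_append assms)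
  \<comment> \<open>Children count from 1, list positions from 0; omitting the last position leaves
    \<open>butlast ts\<close>.\<close>
  also have "\<dots> = (\<Sum>j = 0..<length ts - 1. lp_nested (ts ! j) x powr expo k)"
    by (rule sum.reindex_bij_witness[of _ Suc "\<lambda>j. j - 1"]) auto
  also have "\<dots> = (\<Sum>t\<leftarrow>butlast ts. lp_nested t x powr expo k)"
    by (simp add: sum_list_sum_nth nth_butlast)
  finally show ?thesis .
qed

lemma node_value_conv:
  assumes "k < depth"
  shows "node_value T (node k) x =
    (side_sum k x + node_value T (node (Suc k)) x powr expo k) powr (1 / expo k)"
proof -
  from inner_node[OF assms] obtain ts where ts: "subtree_at T (node k) = Node (expo k) ts"
    "ts \<noteq> []" "node (Suc k) = node k @ [length ts]" by metis
  have "subtree_at T (node (Suc k)) = last ts"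
    unfolding ts(3) subtree_at_append ts(1) using ts(2) by (simp add: last_conv_nth)
  moreover have "(\<Sum>t\<leftarrow>ts. lp_nested t x powr expo k)
    = (\<Sum>t\<leftarrow>butlast ts @ [last ts]. lp_nested t x powr expo k)"
    using ts(2) by simp
  ultimately show ?thesis
    unfolding node_value_def ts(1) side_sum_conv[OF ts(1)] by simp
qed

lemma expo_pos: "k < depth \<Longrightarrow> expo k > 0"
  using inner_node by metis

lemma side_sum_nonneg: "side_sum k x \<ge> 0"
  unfolding side_sum_def by (intro sum_nonneg) auto

lemma side_sum_upd:
  assumes "k < depth"
  shows "side_sum k (x(n := s)) = side_sum k x"
proof -
  from inner_node[OF assms] obtain ts where ts: "subtree_at T (node k) = Node (expo k) ts"
    "\<And>t. t \<in> set (butlast ts) \<Longrightarrow> set (leaves t) \<subseteq> {1..<n}" by metis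
  have "lp_nested t (x(n := s)) = lp_nested t x" if "t \<in> set (butlast ts)" for t
    using ts(2)[OF that] by (intro lp_nested_cong) auto
  then show ?thesis unfolding side_sum_conv[OF ts(1)] by (simp cong: map_cong)
qed

lemma node_value_pos:
  assumes "k \<le> depth" "x n > 0"
  shows "node_value T (node k) x > 0"
proof -
  have "node_value T (node k) x \<noteq> 0"
    using lp_nested_eq_0D[of "subtree_at T (node k)" x n] n_in_leaves[OF assms(1)] assms
      subtree_at_last_path(2)[OF wf] by (auto simp: node_value_def node_def depth_def)
  then show ?thesis using lp_nested_nonneg unfolding node_value_def by (simp add: less_le)
qed

lemma node_value_0: "node_value T (node 0) x = lp_nested T x"
  by (simp add: node_def node_value_def)

lemma node_value_depth: "node_value T (node depth) x = \<bar>x n\<bar>"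
  by (simp add: node_depth node_value_def)

lemma g_term_pos:
  assumes "\<And>k. k < depth \<Longrightarrow> remainder k x > 0" "k \<le> depth"
  shows "g_term T x (node k) > 0"
proof (cases k)
  case (Suc k')
  then show ?thesis using assms(1)[of k'] assms(2) by (simp add: g_term_node_Suc)
qed (simp add: g_term_node_0)

text \<open>Downwards from the root value 1, the recursion for g solves
  \<open>node_value_conv\<close> for the last child. The remainder is then a power of that child's
  value, which is positive because coordinate \<open>n\<close> is.\<close>

lemma g_term_eq_node_value:
  assumes "s > 0" "lp_nested T (x(n := s)) = 1" "k \<le> depth"
  shows "g_term T x (node k) = node_value T (node k) (x(n := s))
    \<and> (k < depth \<longrightarrow> remainder k x > 0)"
proof -
  define y where "y = x(n := s)"
  have pos: "node_value T (node k) y > 0" if "k \<le> depth" for k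
    using node_value_pos[of k y] that assms(1) by (simp add: y_def)
  have side: "side_sum k y = side_sum k x" if "k < depth" for k
    unfolding y_def using that by (rule side_sum_upd)
  have rem: "remainder k x = node_value T (node (Suc k)) y powr expo k" "remainder k x > 0"
    if "g_term T x (node k) = node_value T (node k) y" "k < depth" for k
  proof -
    \<comment> \<open>Nonnegativity is what turns \<open>a powr 1\<close> back into \<open>a\<close>
      once the exponents cancel.\<close>
    have "side_sum k x + node_value T (node (Suc k)) y powr expo k \<ge> 0"
      using side_sum_nonneg by (simp add: add_nonneg_nonneg)
    then show eq: "remainder k x = node_value T (node (Suc k)) y powr expo k"
      using that expo_pos[OF that(2)] side[OF that(2)]
      by (simp add: remainder_def node_value_conv powr_powr)
    show "remainder k x > 0"
      unfolding eq using pos[of "Suc k"] that(2) by simp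
  qed
  have "g_term T x (node k) = node_value T (node k) y"
    using assms(3)
  proof (induction k)
    case 0
    show ?case using assms(2) unfolding g_term_node_0 node_value_0 y_def by (rule sym)
  next
    case (Suc k)
    then have k: "k < depth" "g_term T x (node k) = node_value T (node k) y" by auto
    show ?case
      using rem(1)[OF k(2,1)] expo_pos[OF k(1)] pos[of "Suc k"] k
      by (simp add: g_term_node_Suc powr_powr)
  qed
  with rem(2) show ?thesis unfolding y_def by blast
qed

text \<open>The converse direction, climbing from the leaf: at each node the side sum and the
  remainder add up to the power of g there.\<close>

lemma node_value_eq_g_term:
  assumes "\<And>k. k < depth \<Longrightarrow> remainder k x > 0" "k \<le> depth"
  shows "node_value T (node k) (x(n := g_term T x (node depth))) = g_term T x (node k)"
proof -
  define y where "y = x(n := g_term T x (node depth))"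
  have "node_value T (node k) y = g_term T x (node k)"
    using assms(2)
  proof (induction k rule: inc_induct)
    case base
    show ?case using g_term_pos[OF assms(1) order.refl] by (simp add: node_value_depth y_def)
  next
    case (step k)
    have "g_term T x (node (Suc k)) powr expo k = remainder k x"
      using step expo_pos[of k] assms(1)[of k] by (simp add: g_term_node_Suc powr_powr)
    moreover have "side_sum k y = side_sum k x"
      unfolding y_def using step(2) by (rule side_sum_upd)
    ultimately show ?case
      using step expo_pos[of k] g_term_pos[OF assms(1), of k]
      by (simp add: node_value_conv remainder_def powr_powr)
  qed
  then show ?thesis by (simp add: y_def)
qed

text \<open>Existence comes from climbing the path, where the root gets value 1; uniqueness from
  descending it, which forces the value at the leaf.\<close>

lemma last_polar_eq:
  assumes "\<And>k. k < depth \<Longrightarrow> remainder k x > 0"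
  shows "last_polar T n x = g_term T x (node depth)"
  unfolding last_polar_def
proof (rule the_equality)
  show "g_term T x (node depth) > 0 \<and> lp_nested T (x(n := g_term T x (node depth))) = 1"
    using g_term_pos[OF assms order.refl] node_value_eq_g_term[OF assms, of 0]
    by (simp add: node_value_0 g_term_node_0)
next
  fix s assume "s > 0 \<and> lp_nested T (x(n := s)) = 1"
  then show "s = g_term T x (node depth)"
    using g_term_eq_node_value[of s x depth] by (simp add: node_value_depth)
qed

lemma last_polar_upd_0: "last_polar T n (x(0 := r)) = last_polar T n x"
proof -
  have "lp_nested T (x(0 := r, n := s)) = lp_nested T (x(n := s))" for s
    using leaves by (intro lp_nested_cong) auto
  then show ?thesis by (simp add: last_polar_def)
qed

lemma polar_domain_remainder:
  assumes "u \<in> polar_domain T n" "k < depth"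
  shows "remainder k u > 0"
  using assms g_term_eq_node_value[of _ u k] by (auto simp: polar_domain_def)

section \<open>Radial derivatives of the g terms\<close>

lemma has_radial_deriv_side_sum:
  assumes "k < depth"
  shows "has_radial_deriv (side_sum k) (expo k * side_sum k u) {1..<n} u"
proof -
  from inner_node[OF assms] obtain ts where ts: "subtree_at T (node k) = Node (expo k) ts"
    "\<And>t. t \<in> set (butlast ts) \<Longrightarrow> wf_lp_tree t \<and> set (leaves t) \<subseteq> {1..<n}" by metis
  have "has_radial_deriv (\<lambda>x. \<Sum>t\<leftarrow>butlast ts. lp_nested t x powr expo k)
    (\<Sum>t\<leftarrow>butlast ts. expo k * lp_nested t u powr expo k) {1..<n} u"
    using ts(2)
    by (intro has_radial_deriv_sum_list has_radial_deriv_lp_nested_powr has_radial_deriv_lp_nested)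
      auto
  then show ?thesis by (simp add: side_sum_conv[OF ts(1), abs_def] sum_list_const_mult)
qed

text \<open>The power of g is the remainder plus the side sum, so Euler's identity for the side sum
  lets the result be written through g minus its radial derivative \<open>c\<close>, the quantity
  that propagates along the path.\<close>

lemma has_radial_deriv_remainder:
  assumes "k < depth" "has_radial_deriv (\<lambda>x. g_term T x (node k)) c {1..<n} u"
    "g_term T u (node k) > 0"
  shows "has_radial_deriv (remainder k)
    (expo k * (remainder k u - g_term T u (node k) powr (expo k - 1) * (g_term T u (node k) - c)))
    {1..<n} u"
proof -
  have "g_term T u (node k) powr expo k = g_term T u (node k) powr (expo k - 1) * g_term T u (node k)"
    using assms(3) by (simp add: powr_diff)
  then have "expo k * (remainder k u - g_term T u (node k) powr (expo k - 1) * (g_term T u (node k) - c))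
    = expo k * g_term T u (node k) powr (expo k - 1) * c - expo k * side_sum k u"
    by (simp add: remainder_def algebra_simps)
  with has_radial_deriv_diff[OF has_radial_deriv_powr[OF assms(2,3)] has_radial_deriv_side_sum[OF assms(1)]]
  show ?thesis by (simp add: remainder_def[abs_def])
qed

text \<open>The formula for g minus its radial derivative, solved for the latter. At the root, g is
  constantly 1 and the product is empty, so the value is 0.\<close>

lemma has_radial_deriv_g_term:
  assumes "\<And>k. k < depth \<Longrightarrow> remainder k u > 0" "k \<le> depth"
  shows "has_radial_deriv (\<lambda>x. g_term T x (node k))
    (g_term T u (node k) - g_term T u (node k) powr (1 - expo k) * (\<Prod>i = 1..k. G_term T u (node i)))
    {1..<n} u"
  using assms(2)
proof (induction k)
  case 0
  then show ?case by (simp add: g_term_node_0 has_radial_deriv_const)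
next
  case (Suc k)
  define g where "g k = g_term T u (node k)" for k
  define P where "P = (\<Prod>i = 1..k. G_term T u (node i))"
  have k: "k < depth" using Suc by simp
  have pos: "g k > 0" "g (Suc k) > 0" "remainder k u > 0" "expo k > 0"
    using g_term_pos[OF assms(1)] Suc.prems assms(1)[OF k] expo_pos[OF k] by (auto simp: g_def)
  have "has_radial_deriv (\<lambda>x. g_term T x (node k)) (g k - g k powr (1 - expo k) * P) {1..<n} u"
    using Suc by (simp add: g_def P_def)
  from has_radial_deriv_remainder[OF k this] pos
  have "has_radial_deriv (remainder k)
    (expo k * (remainder k u - g k powr (expo k - 1) * (g k powr (1 - expo k) * P))) {1..<n} u"
    by (simp add: g_def)
  \<comment> \<open>The powers of the old value cancel, so only the product \<open>P\<close> is
    passed on.\<close>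
  also have "g k powr (expo k - 1) * (g k powr (1 - expo k) * P) = P"
    using pos by (simp add: mult.assoc[symmetric] powr_add[symmetric])
  finally have "has_radial_deriv (remainder k) (expo k * (remainder k u - P)) {1..<n} u" .
  from has_radial_deriv_powr[OF this pos(3), of "1 / expo k"]
  have "has_radial_deriv (\<lambda>x. remainder k x powr (1 / expo k))
    (remainder k u powr (1 / expo k - 1) * (remainder k u - P)) {1..<n} u"
    using pos by simp
  \<comment> \<open>From here on all powers are of the new value \<open>g (Suc k)\<close>, whose
    \<open>expo k\<close>-th power is the remainder.\<close>
  also have "remainder k u powr (1 / expo k - 1) = g (Suc k) powr (1 - expo k)"
    using pos k by (simp add: g_def g_term_node_Suc powr_powr field_simps)
  also have "remainder k u = g (Suc k) powr expo k"
    using pos k by (simp add: g_def g_term_node_Suc powr_powr)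
  also have "g (Suc k) powr (1 - expo k) * (g (Suc k) powr expo k - P) =
    g (Suc k) - g (Suc k) powr (1 - expo k) * P"
    using pos by (simp add: right_diff_distrib powr_add[symmetric])
  \<comment> \<open>Changing the exponent from \<open>expo k\<close> to \<open>expo (Suc k)\<close>
    costs exactly the new G term.\<close>
  also have "g (Suc k) powr (1 - expo k) =
    g (Suc k) powr (1 - expo (Suc k)) * G_term T u (node (Suc k))"
  proof -
    have "butlast (node (Suc k)) = node k"
      using k by (simp add: node_def depth_def butlast_take)
    then show ?thesis using pos by (simp add: G_term_def expo_def g_def powr_add[symmetric])
  qed
  finally show ?case using k by (simp add: g_def P_def g_term_node_Suc mult_ac)
qed

section \<open>The path product as a radial derivative of u_n\<close>

lemma leaf_path_eq: "leaf_path T n = node ` {1..depth}"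
proof -
  have "is_node T (last_path T)" "subtree_at T (last_path T) = Leaf n"
    using subtree_at_last_path(4)[OF wf, of depth] node_depth by (auto simp: node_def depth_def)
  moreover have "distinct (leaves T)" unfolding leaves by simp
  ultimately have "leaf_path T n = {L. L \<noteq> [] \<and> prefix L (last_path T)}"
    unfolding leaf_path_def using last_path_unique[OF wf] last_leaves by blast
  also have "\<dots> = node ` {1..depth}"
  proof (intro equalityI subsetI)
    fix L assume "L \<in> {L. L \<noteq> [] \<and> prefix L (last_path T)}"
    then show "L \<in> node ` {1..depth}"
      by (intro image_eqI[of _ _ "length L"])
        (auto simp: node_def depth_def prefix_def Suc_le_eq)
  qed (auto simp: node_def depth_def take_is_prefix)
  finally show ?thesis .
qed

lemma prod_leaf_path: "(\<Prod>L\<in>leaf_path T n. G_term T u L) = (\<Prod>k = 1..depth. G_term T u (node k))"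
proof -
  have "inj_on node {1..depth}"
    by (rule inj_onI) (metis atLeastAtMost_iff depth_def length_take min.absorb2 node_def)
  then show ?thesis unfolding leaf_path_eq by (simp add: prod.reindex)
qed

text \<open>Along a coordinate with \<open>u j \<noteq> 0\<close> the finitely many remainders are
  continuous and stay positive near \<open>u j\<close>, so u_n may be replaced by g under the
  derivative. Coordinates with \<open>u j = 0\<close> contribute nothing.\<close>

lemma last_polar_radial:
  assumes u: "u \<in> polar_domain T n"
  shows "last_polar T n u - (\<Sum>j = 1..<n. u j * partial_deriv (last_polar T n) j u)
    = (\<Prod>L\<in>leaf_path T n. G_term T u L)"
proof -
  let ?g = "\<lambda>x. g_term T x (node depth)"
  note rem = polar_domain_remainder[OF u]
  have "partial_deriv (last_polar T n) j u = partial_deriv ?g j u"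
    if j: "j \<in> {1..<n}" "u j \<noteq> 0" for j
    unfolding partial_deriv_def
  proof (rule deriv_cong_ev)
    have "eventually (\<lambda>t. remainder k (u(j := t)) > 0) (nhds (u j))" if k: "k < depth" for k
    proof -
      have "isCont (\<lambda>t. remainder k (u(j := t))) (u j)"
        using has_radial_deriv_imp_isCont[OF has_radial_deriv_remainder[OF k
          has_radial_deriv_g_term[OF rem] g_term_pos[OF rem]]] j k by simp
      then have "((\<lambda>t. remainder k (u(j := t))) \<longlongrightarrow> remainder k u) (nhds (u j))"
        by (simp add: isCont_def tendsto_nhds_iff)
      then show ?thesis using rem[OF k] by (rule order_tendstoD)
    qed
    then have "eventually (\<lambda>t. \<forall>k\<in>{..<depth}. remainder k (u(j := t)) > 0) (nhds (u j))"
      by (intro eventually_ball_finite) auto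
    then show "eventually (\<lambda>t. last_polar T n (u(j := t)) = ?g (u(j := t))) (nhds (u j))"
      by eventually_elim (auto intro: last_polar_eq)
  qed simp
  then have "u j * partial_deriv (last_polar T n) j u = u j * partial_deriv ?g j u"
    if "j \<in> {1..<n}" for j using that by (cases "u j = 0") auto
  then have "(\<Sum>j = 1..<n. u j * partial_deriv (last_polar T n) j u)
    = (\<Sum>j = 1..<n. u j * partial_deriv ?g j u)" by (intro sum.cong) auto
  \<comment> \<open>At the leaf the exponent is 1, so the power in front of the product
    disappears.\<close>
  also have "\<dots> = ?g u - (\<Prod>k = 1..depth. G_term T u (node k))"
    using has_radial_deriv_imp_partial_deriv[OF has_radial_deriv_g_term[OF rem order.refl]]
      g_term_pos[OF rem order.refl] by (simp add: expo_depth)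
  finally show ?thesis using last_polar_eq[OF rem] by (simp add: prod_leaf_path)
qed

end

section \<open>A determinant by column operations\<close>

text \<open>
  Replacing column \<open>0\<close> by \<open>r\<close> times itself minus \<open>v j\<close> times column \<open>j\<close>, for all \<open>j \<ge> 1\<close>,
  leaves only the last entry of that column.
\<close>

lemma abs_det_bordered_diagonal:
  fixes v w :: "nat \<Rightarrow> real"
  assumes n: "n \<ge> 2" and r: "r > 0"
    and A: "A = Matrix.mat n n (\<lambda>(i, j). if Suc i = n then (if j = 0 then a else w j)
              else if j = 0 then v (Suc i) else if j = Suc i then r else 0)"
  shows "\<bar>Determinant.det A\<bar> = r ^ (n - 2) * \<bar>r * a - (\<Sum>j = 1..<n. v j * w j)\<bar>"
proof -
  define c where "c = r * a - (\<Sum>j = 1..<n. v j * w j)"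
  \<comment> \<open>Right multiplication by \<open>B\<close> performs the column operation. It is
    lower triangular with determinant \<open>r\<close>, the factor cancelled at the end.\<close>
  define B where "B = Matrix.mat n n (\<lambda>(i, j). if j = 0 then (if i = 0 then r else - v i)
    else if i = j then 1 else 0)"
  define C where "C = Matrix.mat n n (\<lambda>(i, j). if j = 0 then (if Suc i = n then c else 0)
    else if Suc i = n then w j else if j = Suc i then r else 0)"
  have carr: "A \<in> carrier_mat n n" "B \<in> carrier_mat n n" "C \<in> carrier_mat n n"
    by (auto simp: A B_def C_def)
  have "A * B = C"
  proof (rule eq_matI)
    fix i j assume "i < dim_row C" "j < dim_col C"
    then have ij: "i < n" "j < n" using carr by auto
    have "(A * B) $$ (i, j) = (\<Sum>k = 0..<n. A $$ (i, k) * B $$ (k, j))"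
      using ij carr by (auto simp: scalar_prod_def)
    also have "\<dots> = C $$ (i, j)"
    proof (cases "j = 0")
      case False
      then have "(\<Sum>k = 0..<n. A $$ (i, k) * B $$ (k, j)) = (\<Sum>k = 0..<n. if k = j then A $$ (i, k) else 0)"
        using ij by (intro sum.cong) (auto simp: B_def)
      also have "\<dots> = A $$ (i, j)" using ij by simp
      finally show ?thesis using False ij by (auto simp: A C_def)
    next
      case True
      have "(\<Sum>k = 0..<n. A $$ (i, k) * B $$ (k, j))
        = A $$ (i, 0) * r - (\<Sum>k = 1..<n. A $$ (i, k) * v k)"
        using n True by (subst sum.atLeast_Suc_lessThan) (auto simp: B_def sum_negf)
      also have "\<dots> = C $$ (i, j)"
      proof (cases "Suc i = n")
        case Tr: True
        then have "(\<Sum>k = 1..<n. A $$ (i, k) * v k) = (\<Sum>k = 1..<n. v k * w k)"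
          using ij by (intro sum.cong) (auto simp: A)
        then show ?thesis using ij n Tr True by (simp add: A C_def c_def)
      next
        case Fa: False
        \<comment> \<open>Row \<open>i\<close> has its entry \<open>r\<close> in column
          \<open>Suc i\<close>, so the sum cancels \<open>r * v (Suc i)\<close> from column
          0.\<close>
        then have "(\<Sum>k = 1..<n. A $$ (i, k) * v k) = (\<Sum>k = 1..<n. if k = Suc i then r * v k else 0)"
          using ij by (intro sum.cong) (auto simp: A)
        also have "\<dots> = r * v (Suc i)" using ij Fa by simp
        finally show ?thesis using ij n Fa True by (simp add: A C_def)
      qed
      finally show ?thesis .
    qed
    finally show "(A * B) $$ (i, j) = C $$ (i, j)" .
  qed (use carr in auto)
  then have "Determinant.det A * Determinant.det B = Determinant.det C"
    using det_mult[OF carr(1,2)] by simp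
  moreover have "Determinant.det B = r"
  proof -
    have "Determinant.det B = prod_list (diag_mat B)"
      by (rule det_lower_triangular[OF _ carr(2)]) (auto simp: B_def)
    also have "\<dots> = (\<Prod>i = 0..<n. if i = 0 then r else 1)"
      unfolding prod_list_diag_prod using carr by (intro prod.cong) (auto simp: B_def)
    also have "\<dots> = r" using n by simp
    finally show ?thesis .
  qed
  moreover have "\<bar>Determinant.det C\<bar> = \<bar>c\<bar> * r ^ (n - 1)"
  proof -
    \<comment> \<open>Column 0 of \<open>C\<close> has only its last entry left; striking it out
      with its row leaves a scalar matrix.\<close>
    have "mat_delete C (n - 1) 0 = r \<cdot>\<^sub>m 1\<^sub>m (n - 1)"
      using n by (intro eq_matI) (auto simp: mat_delete_def C_def)
    then have cof: "\<bar>cofactor C (n - 1) 0\<bar> = r ^ (n - 1)"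
      using r by (simp add: cofactor_def abs_mult power_abs)
    have "Determinant.det C = (\<Sum>i<n. C $$ (i, 0) * cofactor C i 0)"
      using n by (intro laplace_expansion_column[OF carr(3)]) auto
    also have "\<dots> = (\<Sum>i<n. if i = n - 1 then c * cofactor C i 0 else 0)"
      using n by (intro sum.cong) (auto simp: C_def)
    also have "\<dots> = c * cofactor C (n - 1) 0" using n by simp
    finally show ?thesis using cof by (simp add: abs_mult)
  qed
  ultimately have "\<bar>Determinant.det A\<bar> * r = \<bar>c\<bar> * r ^ (n - 1)"
    using r by (metis abs_mult abs_of_pos)
  also have "\<dots> = (r ^ (n - 2) * \<bar>c\<bar>) * r"
    using n by (cases n rule: nat.exhaust) (auto simp: numeral_2_eq_2 dest!: Suc_le_D)
  finally show ?thesis using r by (simp add: c_def)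
qed

section \<open>Assembling the Jacobian determinant\<close>

theorem proposition1:
  fixes n :: nat and T :: lp_tree and \<Delta> r :: real and u :: "nat \<Rightarrow> real"
  assumes "n \<ge> 2"
    and "lp_nested_tree n T"
    and "\<Delta> \<in> {-1, 1}"
    and "r > 0"
    and "u \<in> polar_domain T n"
    and "\<forall>i\<in>{1..n}. \<forall>j<n. has_partial_deriv (\<lambda>q. polar_inverse T n \<Delta> q i) j (u(0 := r))"
  shows "\<bar>Determinant.det (polar_jacobian T n \<Delta> (u(0 := r)))\<bar>
           = r ^ (n - 1) * (\<Prod>L\<in>leaf_path T n. G_term T u L)"
proof -
  interpret nested_tree n T by unfold_locales fact
  define q where "q = u(0 := r)"
  define s where "s = last_polar T n"
  define d where "d j = partial_deriv s j u" for j
  have s_upd: "s (q(0 := t)) = s u" for t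
    by (simp add: s_def q_def last_polar_upd_0)
  have s_q: "s (q(j := t)) = s (u(j := t))" if "j \<noteq> 0" for j t
    using last_polar_upd_0[of "u(j := t)" r] that by (simp add: s_def q_def fun_upd_twist)
  \<comment> \<open>The last row stays abstract in the columns \<open>j \<ge> 1\<close>: only the
    products \<open>u j * w j\<close> enter the determinant.\<close>
  define w where "w j = partial_deriv (\<lambda>q. polar_inverse T n \<Delta> q n) j q" for j
  have jac: "polar_jacobian T n \<Delta> q =
    Matrix.mat n n (\<lambda>(i, j). if Suc i = n then (if j = 0 then \<Delta> * s u else w j)
      else if j = 0 then u (Suc i) else if j = Suc i then r else 0)" (is "_ = ?M")
  proof (rule eq_matI)
    fix i j
    assume "i < dim_row ?M" "j < dim_col ?M"
    then have ij: "i < n" "j < n" by auto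
    have "partial_deriv (\<lambda>q. polar_inverse T n \<Delta> q n) 0 q = \<Delta> * s u"
      unfolding partial_deriv_def polar_inverse_def s_def[symmetric]
      by (rule DERIV_imp_deriv) (auto simp: s_upd intro!: derivative_eq_intros)
    moreover have "partial_deriv (\<lambda>q. polar_inverse T n \<Delta> q (Suc i)) 0 q = u (Suc i)"
      if "Suc i \<noteq> n"
      unfolding partial_deriv_def polar_inverse_def using that
      by (intro DERIV_imp_deriv) (auto simp: q_def intro!: derivative_eq_intros)
    moreover have "partial_deriv (\<lambda>q. polar_inverse T n \<Delta> q (Suc i)) j q = (if j = Suc i then r else 0)"
      if "Suc i \<noteq> n" "j \<noteq> 0"
      unfolding partial_deriv_def polar_inverse_def using that
      by (intro DERIV_imp_deriv) (auto simp: q_def intro!: derivative_eq_intros)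
    ultimately show "polar_jacobian T n \<Delta> q $$ (i, j) = ?M $$ (i, j)"
      using ij by (auto simp: polar_jacobian_def w_def)
  qed (auto simp: polar_jacobian_def)
  \<comment> \<open>At \<open>u j = 0\<close> both sides vanish. Elsewhere, dividing the assumed
    differentiable last coordinate by the nonzero constant \<open>r * \<Delta>\<close> makes u_n
    differentiable, so the constant may leave \<open>deriv\<close>.\<close>
  have w: "u j * w j = r * \<Delta> * (u j * d j)" if "j \<in> {1..<n}" for j
  proof (cases "u j = 0")
    case False
    have j: "j \<noteq> 0" "j \<noteq> n" "j < n" using that by auto
    have eq: "polar_inverse T n \<Delta> (q(j := t)) n = r * \<Delta> * s (u(j := t))" for t
      using j s_q[OF j(1), of t] by (simp add: polar_inverse_def s_def[symmetric]) (simp add: q_def)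
    have c: "r * \<Delta> \<noteq> 0" using assms(3,4) by auto
    have "has_partial_deriv (\<lambda>q. polar_inverse T n \<Delta> q n) j q"
      using assms(1,6) j by (simp add: q_def)
    then have "(\<lambda>t. r * \<Delta> * s (u(j := t))) field_differentiable at (u j)"
      unfolding has_partial_deriv_def eq using j by (simp add: q_def)
    from field_differentiable_mult[OF field_differentiable_const[of "1 / (r * \<Delta>)"] this]
    have "(\<lambda>t. s (u(j := t))) field_differentiable at (u j)" using c by simp
    then have "deriv (\<lambda>t. r * \<Delta> * s (u(j := t))) (u j) = r * \<Delta> * d j"
      by (simp add: d_def partial_deriv_def)
    moreover have "w j = deriv (\<lambda>t. r * \<Delta> * s (u(j := t))) (u j)"
      unfolding w_def partial_deriv_def eq using j by (simp add: q_def)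
    ultimately show ?thesis by simp
  qed simp
  have "r * (\<Delta> * s u) - (\<Sum>j = 1..<n. u j * w j) = r * \<Delta> * (s u - (\<Sum>j = 1..<n. u j * d j))"
    using sum.cong[OF refl w, of "{1..<n}"] by (simp add: sum_distrib_left right_diff_distrib)
  also have "s u - (\<Sum>j = 1..<n. u j * d j) = (\<Prod>L\<in>leaf_path T n. G_term T u L)"
    unfolding s_def d_def by (rule last_polar_radial) fact
  finally have "\<bar>Determinant.det (polar_jacobian T n \<Delta> q)\<bar>
    = r ^ (n - 2) * \<bar>r * \<Delta> * (\<Prod>L\<in>leaf_path T n. G_term T u L)\<bar>"
    using abs_det_bordered_diagonal[OF assms(1,4) jac] by simp
  \<comment> \<open>The absolute value removes \<Delta> and leaves the product as it is, since
    \<open>powr\<close> is never negative.\<close>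
  also have "(\<Prod>L\<in>leaf_path T n. G_term T u L) \<ge> 0"
    by (intro prod_nonneg) (auto simp: G_term_def)
  then have "\<bar>r * \<Delta> * (\<Prod>L\<in>leaf_path T n. G_term T u L)\<bar> = r * (\<Prod>L\<in>leaf_path T n. G_term T u L)"
    using assms(3,4) by (auto simp: abs_mult)
  also have "r ^ (n - 2) * (r * (\<Prod>L\<in>leaf_path T n. G_term T u L))
    = r ^ (n - 1) * (\<Prod>L\<in>leaf_path T n. G_term T u L)"
  proof -
    have "n - 1 = Suc (n - 2)" using assms(1) by simp
    then show ?thesis by simp
  qed
  finally show ?thesis unfolding q_def .
qed

end
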